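(* Let $\lambda$ be a partition with at most $n$ parts and let $\pi$ be a $\lambda$-permutation. If $\pi$ is $\lambda$-312-avoiding, then the set of Demazure tableaux $\mathcal{D}_\lambda(\pi)$ equals the principal ideal $[Y_\lambda(\pi)] = \{T \in \mathcal{T}_\lambda : T \leq Y_\lambda(\pi)\}$ of $\mathcal{T}_\lambda$.
   Context: Fix $n \geq 1$; write $[m]=\{1,\dots,m\}$ and $(a,b]=\{a+1,\dots,b\}$. A partition is $\lambda=(\lambda_1\ge\cdots\ge\lambda_n\ge 0)\in\mathbb{Z}^n$, $|\lambda|=\sum\lambda_i$. Its shape has boxes $(j,i)$ (column $j$, row $i$) for $1\le j\le\lambda_1$, $1\le i\le\zeta_j$, where $\zeta_j=\#\{i:\lambda_i\ge j\}$. Let $R_\lambda\subseteq[n-1]$ be the set of column lengths $\zeta_j$ that are less than $n$; write $R_\lambda=\{q_1<\cdots<q_r\}$, $q_0=0$, $q_{r+1}=n$; the $h$-th carrel is $(q_{h-1},q_h]$, and $\lambda_i$ is constant on each carrel. A tableau of shape $\lambda$ is a filling $T$ with values $T_j(i)\in[n]$ strictly increasing down columns and weakly increasing along rows; $\mathcal{T}_\lambda$ is the set of these, ordered entrywise. A $\lambda$-permutation is a permutation $\pi=(\pi_1,\dots,\pi_n)$ of $[n]$ that is strictly increasing on each carrel. It is $\lambda$-312-containing if there exist $h\in[r-1]$ and indices $a\le q_h<b\le q_{h+1}<c\le n$ with $\pi_b<\pi_c<\pi_a$, and $\lambda$-312-avoiding otherwise. For $Q\subseteq[n]$, $Y(Q)$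 is the single column containing the elements of $Q$ increasing downward. With $B_h=\{\pi_1,\dots,\pi_{q_h}\}$, the $\lambda$-key $Y_\lambda(\pi)\in\mathcal{T}_\lambda$ has as columns, left to right, $\lambda_n$ copies of $Y([n])$ followed, for $h=r,r-1,\dots,1$ in turn, by $\lambda_{q_h}-\lambda_{q_{h+1}}$ copies of $Y(B_h)$. Scanning tableau $S(T)$ of $T\in\mathcal{T}_\lambda$: the earliest weakly increasing subsequence (EWIS) of a sequence $x_1,x_2,\dots$ is $x_{i_1},x_{i_2},\dots$ with $i_1=1$ and $i_u$ the smallest index $>i_{u-1}$ with $x_{i_u}\ge x_{i_{u-1}}$. To fill column $j$ of $S(T)$: start with the boxes of $T$ in columns $j,\dots,\lambda_1$ unmarked; repeat $\zeta_j$ times: read left to right the values in the lowest unmarked box of each of these columns still having unmarked boxes, form the EWIS of this sequence, mark the boxes contributing to it, and write the last value of the EWIS in the lowest empty box of column $j$ of $S(T)$ (the unmarked boxes always form a partition shape). The Demazure set is $\mathcal{D}_\lambda(\pi)=\{T\in\mathcal{T}_\lambda: S(T)\le Y_\lambda(\pi)\}$. *)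

theory Defs
  imports Main "HOL-Combinatorics.Permutations"
begin

text \<open>
  A partition is a function \<open>lam\<close> of which only the values at \<open>1, \<dots>, n\<close> matter.  A filling
  \<open>T\<close> of its shape is a function with \<open>T j i\<close> the entry in column \<open>j\<close> and row \<open>i\<close>, rows being
  numbered downward; it is normalised to \<open>0\<close> off the shape, so that distinct functions are
  distinct tableaux.
\<close>

definition is_partition :: "nat \<Rightarrow> (nat \<Rightarrow> nat) \<Rightarrow> bool" where
  "is_partition n lam \<longleftrightarrow> (\<forall>i j. 1 \<le> i \<and> i \<le> j \<and> j \<le> n \<longrightarrow> lam j \<le> lam i)"

definition col_len :: "nat \<Rightarrow> (nat \<Rightarrow> nat) \<Rightarrow> nat \<Rightarrow> nat" where
  "col_len n lam j = card {i \<in> {1..n}. j \<le> lam i}"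

definition boxes :: "nat \<Rightarrow> (nat \<Rightarrow> nat) \<Rightarrow> (nat \<times> nat) set" where
  "boxes n lam = (SIGMA j:{1..lam 1}. {1..col_len n lam j})"

definition short_lens :: "nat \<Rightarrow> (nat \<Rightarrow> nat) \<Rightarrow> nat set" where
  "short_lens n lam = {q \<in> col_len n lam ` {1..lam 1}. q < n}"

definition num_short :: "nat \<Rightarrow> (nat \<Rightarrow> nat) \<Rightarrow> nat" where
  "num_short n lam = card (short_lens n lam)"

text \<open>The sequence \<open>q\<^sub>0 = 0 < q\<^sub>1 < \<dots> < q\<^sub>r < q\<^sub>r\<^sub>+\<^sub>1 = n\<close>, where \<open>r = num_short n lam\<close>.\<close>

definition qseq :: "nat \<Rightarrow> (nat \<Rightarrow> nat) \<Rightarrow> nat \<Rightarrow> nat" where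
  "qseq n lam h = (0 # sorted_list_of_set (short_lens n lam) @ [n]) ! h"

definition carrel :: "nat \<Rightarrow> (nat \<Rightarrow> nat) \<Rightarrow> nat \<Rightarrow> nat set" where
  "carrel n lam h = {qseq n lam (h - 1) <.. qseq n lam h}"

definition tableaux :: "nat \<Rightarrow> (nat \<Rightarrow> nat) \<Rightarrow> (nat \<Rightarrow> nat \<Rightarrow> nat) set" where
  "tableaux n lam = {T.
     (\<forall>(j, i) \<in> boxes n lam. T j i \<in> {1..n}) \<and>
     (\<forall>j i i'. (j, i) \<in> boxes n lam \<and> (j, i') \<in> boxes n lam \<and> i < i' \<longrightarrow> T j i < T j i') \<and>
     (\<forall>j j' i. (j, i) \<in> boxes n lam \<and> (j', i) \<in> boxes n lam \<and> j < j' \<longrightarrow> T j i \<le> T j' i) \<and>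
     (\<forall>j i. (j, i) \<notin> boxes n lam \<longrightarrow> T j i = 0)}"

definition tab_le :: "nat \<Rightarrow> (nat \<Rightarrow> nat) \<Rightarrow> (nat \<Rightarrow> nat \<Rightarrow> nat) \<Rightarrow> (nat \<Rightarrow> nat \<Rightarrow> nat) \<Rightarrow> bool" where
  "tab_le n lam T U \<longleftrightarrow> (\<forall>(j, i) \<in> boxes n lam. T j i \<le> U j i)"

definition principal_ideal :: "nat \<Rightarrow> (nat \<Rightarrow> nat) \<Rightarrow> (nat \<Rightarrow> nat \<Rightarrow> nat) \<Rightarrow> (nat \<Rightarrow> nat \<Rightarrow> nat) set" where
  "principal_ideal n lam U = {T \<in> tableaux n lam. tab_le n lam T U}"

definition is_lam_perm :: "nat \<Rightarrow> (nat \<Rightarrow> nat) \<Rightarrow> (nat \<Rightarrow> nat) \<Rightarrow> bool" where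
  "is_lam_perm n lam \<pi> \<longleftrightarrow> \<pi> permutes {1..n} \<and>
     (\<forall>h \<in> {1..num_short n lam + 1}. strict_mono_on (carrel n lam h) \<pi>)"

definition lam_312_containing :: "nat \<Rightarrow> (nat \<Rightarrow> nat) \<Rightarrow> (nat \<Rightarrow> nat) \<Rightarrow> bool" where
  "lam_312_containing n lam \<pi> \<longleftrightarrow>
     (\<exists>h \<in> {1..<num_short n lam}. \<exists>a b c.
        1 \<le> a \<and> a \<le> qseq n lam h \<and>
        qseq n lam h < b \<and> b \<le> qseq n lam (h + 1) \<and>
        qseq n lam (h + 1) < c \<and> c \<le> n \<and>
        \<pi> b < \<pi> c \<and> \<pi> c < \<pi> a)"

definition lam_312_avoiding :: "nat \<Rightarrow> (nat \<Rightarrow> nat) \<Rightarrow> (nat \<Rightarrow> nat) \<Rightarrow> bool" where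
  "lam_312_avoiding n lam \<pi> \<longleftrightarrow> \<not> lam_312_containing n lam \<pi>"

text \<open>The entry in row \<open>i\<close> of the column \<open>Y(Q)\<close>.\<close>

definition col_of_set :: "nat set \<Rightarrow> nat \<Rightarrow> nat" where
  "col_of_set Q i = sorted_list_of_set Q ! (i - 1)"

definition key_columns :: "nat \<Rightarrow> (nat \<Rightarrow> nat) \<Rightarrow> (nat \<Rightarrow> nat) \<Rightarrow> nat set list" where
  "key_columns n lam \<pi> =
     replicate (lam n) {1..n} @
     concat (map (\<lambda>h. replicate (lam (qseq n lam h) - lam (qseq n lam (h + 1)))
                                (\<pi> ` {1..qseq n lam h}))
                 (rev [1..<num_short n lam + 1]))"

definition lam_key :: "nat \<Rightarrow> (nat \<Rightarrow> nat) \<Rightarrow> (nat \<Rightarrow> nat) \<Rightarrow> nat \<Rightarrow> nat \<Rightarrow> nat" where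
  "lam_key n lam \<pi> j i =
     (if (j, i) \<in> boxes n lam then col_of_set (key_columns n lam \<pi> ! (j - 1)) i else 0)"

text \<open>
  The earliest weakly increasing subsequence with respect to the values \<open>v x\<close>, keeping track of
  the contributing items \<open>x\<close> themselves.
\<close>

function ewis :: "('a \<Rightarrow> nat) \<Rightarrow> 'a list \<Rightarrow> 'a list" where
  "ewis v [] = []"
| "ewis v (x # xs) = x # ewis v (dropWhile (\<lambda>y. v y < v x) xs)"
  by pat_completeness auto
termination
  by (relation "measure (\<lambda>(v, xs). length xs)") (auto simp: less_Suc_eq_le length_dropWhile_le)

text \<open>For a set \<open>U\<close> of unmarked boxes: the lowest one in each nonempty column, left to right.\<close>

definition lowest_boxes :: "(nat \<times> nat) set \<Rightarrow> (nat \<times> nat) list" where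
  "lowest_boxes U = map (\<lambda>k. (k, Max (U `` {k}))) (sorted_list_of_set (fst ` U))"

definition scan_ewis :: "(nat \<Rightarrow> nat \<Rightarrow> nat) \<Rightarrow> (nat \<times> nat) set \<Rightarrow> (nat \<times> nat) list" where
  "scan_ewis T U = ewis (\<lambda>(k, i). T k i) (lowest_boxes U)"

text \<open>
  The unmarked boxes after \<open>t\<close> rounds of the procedure that fills column \<open>j\<close>.  The next round
  writes into row \<open>col_len n lam j - t\<close> of the scanning tableau, hence row \<open>i\<close> is filled after
  \<open>col_len n lam j - i\<close> rounds have been completed.
\<close>

fun unmarked :: "nat \<Rightarrow> (nat \<Rightarrow> nat) \<Rightarrow> (nat \<Rightarrow> nat \<Rightarrow> nat) \<Rightarrow> nat \<Rightarrow> nat \<Rightarrow> (nat \<times> nat) set" where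
  "unmarked n lam T j 0 = {b \<in> boxes n lam. j \<le> fst b}"
| "unmarked n lam T j (Suc t) =
     unmarked n lam T j t - set (scan_ewis T (unmarked n lam T j t))"

definition scanning :: "nat \<Rightarrow> (nat \<Rightarrow> nat) \<Rightarrow> (nat \<Rightarrow> nat \<Rightarrow> nat) \<Rightarrow> nat \<Rightarrow> nat \<Rightarrow> nat" where
  "scanning n lam T j i =
     (if (j, i) \<in> boxes n lam
      then case last (scan_ewis T (unmarked n lam T j (col_len n lam j - i))) of (k, m) \<Rightarrow> T k m
      else 0)"

definition demazure :: "nat \<Rightarrow> (nat \<Rightarrow> nat) \<Rightarrow> (nat \<Rightarrow> nat) \<Rightarrow> (nat \<Rightarrow> nat \<Rightarrow> nat) set" where
  "demazure n lam \<pi> = {T \<in> tableaux n lam. tab_le n lam (scanning n lam T) (lam_key n lam \<pi>)}"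

end

theory Submission
  imports Defs
begin

text \<open>
  An EWIS consists of the weak left-to-right maxima of its sequence, so \<open>S\<^sub>j(i)\<close> is the largest
  entry among the lowest unmarked boxes of columns \<open>\<ge> j\<close>, where column \<open>j\<close> is unmarked exactly
  down to row \<open>i\<close>. Hence \<open>T \<le> S(T)\<close>, and the columns of \<open>S(T)\<close> increase strictly.

  Conversely let \<open>T \<le> Y\<close>, where \<open>Y\<close> is the key of \<open>\<pi>\<close>, and write \<open>S\<^sub>j(i) = T\<^sub>k(m)\<close> with \<open>k \<ge> j\<close>
  and \<open>m \<le> i\<close>. Either \<open>T\<^sub>k(m) \<le> Y\<^sub>k(m) \<le> Y\<^sub>j(i)\<close>, or column \<open>j\<close> of \<open>Y\<close> has an entry
  \<open>\<le> Y\<^sub>j(i)\<close> that is missing from column \<open>k\<close>, while column \<open>k\<close> has an entry \<open>> Y\<^sub>j(i)\<close>. In the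
  second case 312-avoidance forces \<open>Y\<^sub>j(i) + 1\<close> into column \<open>j\<close>, so that
  \<open>S\<^sub>j(i) < S\<^sub>j(i + 1) \<le> Y\<^sub>j(i + 1) = Y\<^sub>j(i) + 1\<close> by downward induction on \<open>i\<close>.
\<close>

section \<open>Earliest weakly increasing subsequences\<close>

lemma ewis_eq_Nil_iff [simp]: "ewis v xs = [] \<longleftrightarrow> xs = []"
  by (cases xs) auto

text \<open>\<open>R\<close> is the order of positions; being asymmetric, it keeps an item from
  preceding itself. Items skipped after the head lie below it, so they are not weak left-to-right
  maxima and impose nothing on the later chosen items; what remains is the same question for the
  shortened list.\<close>

lemma mem_ewis_iff:
  assumes "asymp R" "sorted_wrt R xs"
  shows "x \<in> set (ewis v xs) \<longleftrightarrow> x \<in> set xs \<and> (\<forall>y \<in> set xs. R y x \<longrightarrow> v y \<le> v x)"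
  using assms
proof (induction v xs rule: ewis.induct)
  case (2 v a xs)
  define ds where "ds = dropWhile (\<lambda>y. v y < v a) xs"
  define ts where "ts = takeWhile (\<lambda>y. v y < v a) xs"
  have xs: "xs = ts @ ds"
    by (simp add: ds_def ts_def)
  have sorted: "sorted_wrt R ts" "sorted_wrt R ds"
    "\<And>y. y \<in> set xs \<Longrightarrow> R a y" "\<And>y z. y \<in> set ts \<Longrightarrow> z \<in> set ds \<Longrightarrow> R y z"
    using "2.prems" by (auto simp: xs sorted_wrt_append)
  have ts: "v y < v a" if "y \<in> set ts" for y
    using that set_takeWhileD unfolding ts_def by metis
  have hd: "v a \<le> v (hd ds)" if "ds \<noteq> []"
    using hd_dropWhile[OF that[unfolded ds_def]] by (simp add: ds_def)
  have IH: "x \<in> set (ewis v ds) \<longleftrightarrow> x \<in> set ds \<and> (\<forall>y \<in> set ds. R y x \<longrightarrow> v y \<le> v x)"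
    using "2.IH" "2.prems"(1) sorted(2) by (simp add: ds_def)
  have asym: "R y z \<Longrightarrow> \<not> R z y" for y z
    using "2.prems"(1) by (auto dest: asympD)
  have ewis: "ewis v (a # xs) = a # ewis v ds"
    by (simp add: ds_def)
  show ?case
  proof
    assume "x \<in> set (ewis v (a # xs))"
    then consider "x = a" | "x \<in> set (ewis v ds)"
      unfolding ewis by auto
    then show "x \<in> set (a # xs) \<and> (\<forall>y\<in>set (a # xs). R y x \<longrightarrow> v y \<le> v x)"
    proof cases
      case 1
      then show ?thesis using asym sorted(3) by auto
    next
      case 2
      then have x: "x \<in> set ds" "\<forall>y \<in> set ds. R y x \<longrightarrow> v y \<le> v x"
        using IH by auto
      then obtain d ds' where d: "ds = d # ds'"
        by (cases ds) auto
      \<comment> \<open>Either \<open>d\<close> is \<open>x\<close> itself or it precedes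
        \<open>x\<close>. Since \<open>d\<close> stopped the skipping, this puts \<open>x\<close> at
        or above \<open>a\<close>, and thereby above all skipped items.\<close>
      have "v d \<le> v x"
        using x sorted(2) unfolding d by auto
      then have "v a \<le> v x"
        using hd by (simp add: d)
      then show ?thesis
        using x ts unfolding xs by force
    qed
  next
    assume x: "x \<in> set (a # xs) \<and> (\<forall>y\<in>set (a # xs). R y x \<longrightarrow> v y \<le> v x)"
    show "x \<in> set (ewis v (a # xs))"
    proof (cases "x = a")
      case False
      then have "x \<in> set xs" "v a \<le> v x"
        using x sorted(3) by auto
      then have "x \<in> set ds"
        using ts[of x] unfolding xs by auto
      then have "x \<in> set (ewis v ds)"
        unfolding IH using x by (auto simp: xs)
      then show ?thesis
        unfolding ewis by simp
    qed (simp add: ewis)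
  qed
qed simp

text \<open>Skipped items lie below the head, and the head is at most the next chosen item, so the
  bound passes along the chosen items to the last one.\<close>

lemma le_last_ewis: "x \<in> set xs \<Longrightarrow> v x \<le> v (last (ewis v xs))"
proof (induction v xs arbitrary: x rule: ewis.induct)
  case (2 v a xs)
  define ds where "ds = dropWhile (\<lambda>y. v y < v a) xs"
  have small: "v y < v a" if "y \<in> set xs" "y \<notin> set ds" for y
  proof -
    have "y \<in> set (takeWhile (\<lambda>y. v y < v a) xs)"
      using that set_append[of "takeWhile (\<lambda>y. v y < v a) xs" ds]
      by (auto simp: ds_def)
    then show ?thesis by (metis set_takeWhileD)
  qed
  have IH: "v y \<le> v (last (ewis v ds))" if "y \<in> set ds" for y
    using "2.IH" that by (simp add: ds_def)
  have last: "last (ewis v (a # xs)) = (if ds = [] then a else last (ewis v ds))"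
    by (simp add: ds_def)
  have "v a \<le> v (last (ewis v (a # xs)))"
  proof (cases "ds = []")
    case False
    then have "v a \<le> v (hd ds)"
      using hd_dropWhile[of "\<lambda>y. v y < v a" xs] by (simp add: ds_def)
    also have "\<dots> \<le> v (last (ewis v ds))"
      using IH False by simp
    finally show ?thesis
      using False last by simp
  next
    case True
    then show ?thesis unfolding last by simp
  qed
  moreover have "v x \<le> v (last (ewis v (a # xs)))" if "x \<in> set ds"
    unfolding last using that IH[of x] by auto
  ultimately show ?case
    using "2.prems" small[of x] by (metis less_imp_le order_trans set_ConsD)
qed simp

section \<open>Unmarked boxes as column heights\<close>

text \<open>The shape that the unmarked boxes always have. It reduces a round of scanning to a
  change of the height function \<open>c\<close>.\<close>

definition region :: "nat \<Rightarrow> nat \<Rightarrow> (nat \<Rightarrow> nat) \<Rightarrow> (nat \<times> nat) set" where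
  "region j e c = {(k, i). k \<in> {j..e} \<and> i \<in> {1..c k}}"

definition left_max :: "(nat \<Rightarrow> nat \<Rightarrow> nat) \<Rightarrow> nat \<Rightarrow> (nat \<Rightarrow> nat) \<Rightarrow> nat \<Rightarrow> bool" where
  "left_max T j c k \<longleftrightarrow> (\<forall>l \<in> {j..k}. T l (c l) \<le> T k (c k))"

text \<open>The heights after \<open>t\<close> rounds, defined without lists or sets of boxes.
  Truncated subtraction keeps an exhausted column at height 0.\<close>

primrec heights :: "(nat \<Rightarrow> nat \<Rightarrow> nat) \<Rightarrow> nat \<Rightarrow> (nat \<Rightarrow> nat) \<Rightarrow> nat \<Rightarrow> nat \<Rightarrow> nat" where
  "heights T j c 0 = c"
| "heights T j c (Suc t) =
     (\<lambda>k. heights T j c t k - (if left_max T j (heights T j c t) k then 1 else 0))"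

lemma lowest_boxes_region:
  "lowest_boxes (region j e c) =
     map (\<lambda>k. (k, c k)) (sorted_list_of_set {k \<in> {j..e}. 0 < c k})"
proof -
  have fst: "fst ` region j e c = {k \<in> {j..e}. 0 < c k}"
    by (force simp: region_def image_iff)
  have "Max (region j e c `` {k}) = c k" if "k \<in> {j..e}" "0 < c k" for k
  proof -
    have "region j e c `` {k} = {1..c k}"
      using that by (auto simp: region_def)
    then show ?thesis
      using that by (auto intro!: Max_eqI)
  qed
  then show ?thesis
    unfolding lowest_boxes_def fst by auto
qed

text \<open>Heights decrease weakly, so every column to the left of a nonempty one is nonempty.
  Hence \<open>left_max\<close>, which compares with all columns from \<open>j\<close> on, sees
  exactly the preceding items of the scanned list.\<close>

lemma set_scan_ewis_region:
  assumes "antimono_on {j..e} c"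
  shows "set (scan_ewis T (region j e c)) =
    {(k, i). k \<in> {j..e} \<and> 0 < c k \<and> i = c k \<and> left_max T j c k}"
proof -
  define xs where "xs = lowest_boxes (region j e c)"
  have set: "set xs = {(k, i). k \<in> {j..e} \<and> 0 < c k \<and> i = c k}"
    by (auto simp: xs_def lowest_boxes_region)
  have sorted: "sorted_wrt (\<lambda>x y. fst x < fst y) xs"
    by (simp add: xs_def lowest_boxes_region sorted_wrt_map)
  have asym: "asymp (\<lambda>x y :: nat \<times> nat. fst x < fst y)"
    by (auto intro: asympI)
  have pos: "0 < c l" if "l \<in> {j..k}" "k \<in> {j..e}" "0 < c k" for k l
    using monotone_onD[OF assms, of l k] that by auto
  have "(\<forall>y \<in> set xs. fst y < k \<longrightarrow> (case y of (l, i) \<Rightarrow> T l i) \<le> T k (c k)) \<longleftrightarrow> left_max T j c k"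
    if k: "k \<in> {j..e}" "0 < c k" for k
  proof -
    have "{j..k} = insert k {l \<in> {j..e}. 0 < c l \<and> l < k}"
      using k pos by force
    then show ?thesis
      by (auto simp: set left_max_def)
  qed
  moreover have "x \<in> set (scan_ewis T (region j e c)) \<longleftrightarrow> x \<in> set xs \<and>
    (\<forall>y \<in> set xs. fst y < fst x \<longrightarrow> (case y of (l, i) \<Rightarrow> T l i) \<le> (case x of (l, i) \<Rightarrow> T l i))" for x
    unfolding scan_ewis_def xs_def[symmetric] by (rule mem_ewis_iff[OF asym sorted])
  ultimately show ?thesis
    unfolding set by auto
qed

lemma region_diff_scan_ewis:
  assumes "antimono_on {j..e} c"
  shows "region j e c - set (scan_ewis T (region j e c)) =
    region j e (\<lambda>k. c k - (if left_max T j c k then 1 else 0))"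
  unfolding set_scan_ewis_region[OF assms] by (auto simp: region_def split: if_splits)

lemma scan_ewis_region_last:
  assumes "antimono_on {j..e} c" "j \<le> e" "0 < c j"
  obtains k where "k \<in> {j..e}" "0 < c k" "last (scan_ewis T (region j e c)) = (k, c k)"
    "\<And>l. l \<in> {j..e} \<Longrightarrow> 0 < c l \<Longrightarrow> T l (c l) \<le> T k (c k)"
proof -
  let ?x = "last (scan_ewis T (region j e c))"
  have set: "set (lowest_boxes (region j e c)) = {(k, i). k \<in> {j..e} \<and> 0 < c k \<and> i = c k}"
    by (auto simp: lowest_boxes_region)
  then have "lowest_boxes (region j e c) \<noteq> []"
    using assms(2,3) by force
  then have "?x \<in> set (scan_ewis T (region j e c))"
    unfolding scan_ewis_def by (intro last_in_set) simp
  then obtain k where k: "k \<in> {j..e}" "0 < c k" "?x = (k, c k)"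
    unfolding set_scan_ewis_region[OF assms(1)] by auto
  moreover have "T l (c l) \<le> T k (c k)" if "l \<in> {j..e}" "0 < c l" for l
    using le_last_ewis[of "(l, c l)" "lowest_boxes (region j e c)" "\<lambda>(k, i). T k i"] that k(3)
    by (simp add: set scan_ewis_def)
  ultimately show ?thesis
    using that by blast
qed

section \<open>Column lengths of a partition\<close>

text \<open>The duality of \<open>lam\<close> with its conjugate \<open>col_len\<close>: as
  \<open>lam\<close> decreases weakly, the rows reaching column \<open>j\<close> form an initial
  segment.\<close>

lemma le_col_len_iff:
  assumes "is_partition n lam" "i \<in> {1..n}"
  shows "i \<le> col_len n lam j \<longleftrightarrow> j \<le> lam i"
proof
  assume "j \<le> lam i"
  then have "{1..i} \<subseteq> {i \<in> {1..n}. j \<le> lam i}"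
    using assms by (force simp: is_partition_def)
  then have "card {1..i} \<le> col_len n lam j"
    unfolding col_len_def by (intro card_mono) auto
  then show "i \<le> col_len n lam j" by simp
next
  assume i: "i \<le> col_len n lam j"
  show "j \<le> lam i"
  proof (rule ccontr)
    assume "\<not> j \<le> lam i"
    then have "{i \<in> {1..n}. j \<le> lam i} \<subseteq> {1..<i}"
      using assms unfolding is_partition_def by (force simp: not_less[symmetric])
    then have "col_len n lam j \<le> card {1..<i}"
      unfolding col_len_def by (intro card_mono) auto
    then show False
      using i assms(2) by auto
  qed
qed

lemma col_len_le: "col_len n lam j \<le> n"
proof -
  have "card {i \<in> {1..n}. j \<le> lam i} \<le> card {1..n}"
    by (intro card_mono) auto
  then show ?thesis by (simp add: col_len_def)
qed

lemma antimono_col_len: "j \<le> k \<Longrightarrow> col_len n lam k \<le> col_len n lam j"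
  unfolding col_len_def by (intro card_mono) auto

lemma heights_le: "heights T j c t k \<le> c k"
  by (induction t) (auto intro: le_trans[OF diff_le_self])

section \<open>The scanning tableau of a fixed tableau\<close>

locale tableau =
  fixes n :: nat and lam :: "nat \<Rightarrow> nat" and T :: "nat \<Rightarrow> nat \<Rightarrow> nat"
  assumes tableau: "T \<in> tableaux n lam"
begin

abbreviation "h \<equiv> \<lambda>j. heights T j (col_len n lam)"

lemma column_less:
  "\<lbrakk>k \<in> {1..lam 1}; 0 < i; i < i'; i' \<le> col_len n lam k\<rbrakk> \<Longrightarrow> T k i < T k i'"
  using tableau by (auto simp: tableaux_def boxes_def)

lemma row_le:
  assumes "1 \<le> k" "k \<le> k'" "k' \<le> lam 1" "0 < i" "i \<le> col_len n lam k'"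
  shows "T k i \<le> T k' i"
proof (cases "k = k'")
  case False
  then have "(k, i) \<in> boxes n lam" "(k', i) \<in> boxes n lam" "k < k'"
    using assms antimono_col_len[of k k' n lam] by (auto simp: boxes_def)
  then show ?thesis
    using tableau unfolding tableaux_def by blast
qed simp

text \<open>
  The unmarked boxes keep forming a partition shape: if a column is marked, then so is every
  later column of the same height, its entry in that row being at least as large.
\<close>

lemma antimono_heights:
  assumes "1 \<le> j"
  shows "antimono_on {j..lam 1} (h j t)"
proof (induction t)
  case 0
  then show ?case by (auto intro!: monotone_onI antimono_col_len)
next
  case (Suc t)
  note IH = monotone_onD[OF Suc]
  show ?case
  proof (rule monotone_onI)
    fix k k'
    assume k: "k \<in> {j..lam 1}" "k' \<in> {j..lam 1}" "k \<le> k'"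
    have le: "h j t k' \<le> h j t k"
      using IH k by simp
    have "left_max T j (h j t) k'"
      if max: "left_max T j (h j t) k" and eq: "h j t k' = h j t k" and pos: "0 < h j t k'"
      unfolding left_max_def
    proof
      fix l
      assume l: "l \<in> {j..k'}"
      have row: "T m (h j t k') \<le> T k' (h j t k')" if "m \<in> {j..k'}" for m
        using row_le[of m k' "h j t k'"] that k assms pos heights_le by auto
      show "T l (h j t l) \<le> T k' (h j t k')"
      proof (cases "l \<le> k")
        case True
        then have "T l (h j t l) \<le> T k (h j t k)"
          using max l by (auto simp: left_max_def)
        also have "\<dots> \<le> T k' (h j t k')"
          using row[of k] k eq by auto
        finally show ?thesis .
      next
        case False
        \<comment> \<open>Column \<open>l\<close> lies between \<open>k\<close> and
          \<open>k'\<close>, whose heights agree, so it is squeezed to the same height.\<close>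
        then have "h j t l = h j t k'"
          using IH[of k l] IH[of l k'] k l eq by auto
        then show ?thesis
          using row l by simp
      qed
    qed
    \<comment> \<open>A round lowers a height by at most one, so the order could break only if
      \<open>k\<close> is marked and \<open>k'\<close> is not while both have the same positive
      height.\<close>
    then show "h j (Suc t) k' \<le> h j (Suc t) k"
      using le by (cases "h j t k' = h j t k"; cases "h j t k'") auto
  qed
qed

text \<open>Column \<open>j\<close> is the first one scanned, so its lowest box opens the EWIS and
  it loses one box per round.\<close>

lemma heights_first: "h j t j = col_len n lam j - t"
  by (induction t) (auto simp: left_max_def)

lemma unmarked_eq_region:
  assumes "1 \<le> j"
  shows "unmarked n lam T j t = region j (lam 1) (h j t)"
proof (induction t)
  case 0
  then show ?case using assms by (auto simp: boxes_def region_def)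
next
  case (Suc t)
  then show ?case
    using region_diff_scan_ewis[OF antimono_heights[OF assms]] by simp
qed

text \<open>From here on the scanning tableau is handled through heights alone. In the round in
  question column \<open>j\<close> has height \<open>i\<close>, which bounds the heights of all
  later columns.\<close>

lemma scanning_is_max:
  assumes "(j, i) \<in> boxes n lam"
  defines "c \<equiv> h j (col_len n lam j - i)"
  obtains k where "k \<in> {j..lam 1}" "0 < c k" "c k \<le> i" "scanning n lam T j i = T k (c k)"
    "\<And>l. l \<in> {j..lam 1} \<Longrightarrow> 0 < c l \<Longrightarrow> T l (c l) \<le> T k (c k)"
proof -
  have j: "1 \<le> j" "j \<le> lam 1" "0 < i" "i \<le> col_len n lam j"
    using assms by (auto simp: boxes_def)
  have anti: "antimono_on {j..lam 1} c"
    unfolding c_def by (rule antimono_heights[OF j(1)])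
  have cj: "c j = i"
    using heights_first j by (simp add: c_def)
  then have "0 < c j"
    using j by simp
  from scan_ewis_region_last[OF anti j(2) this, of T] obtain k where
    k: "k \<in> {j..lam 1}" "0 < c k" "last (scan_ewis T (region j (lam 1) c)) = (k, c k)"
    "\<And>l. l \<in> {j..lam 1} \<Longrightarrow> 0 < c l \<Longrightarrow> T l (c l) \<le> T k (c k)"
    by metis
  moreover have "c k \<le> i"
    using monotone_onD[OF anti, of j k] k j cj by auto
  moreover have "scanning n lam T j i = T k (c k)"
    using assms(1) k(3) unmarked_eq_region[OF j(1)] by (simp add: scanning_def c_def)
  ultimately show ?thesis
    using that by blast
qed

text \<open>The box \<open>(j, i)\<close> is the lowest unmarked one of column \<open>j\<close> in
  its round, so its entry takes part in the maximum.\<close>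

lemma le_scanning:
  assumes "(j, i) \<in> boxes n lam"
  shows "T j i \<le> scanning n lam T j i"
proof -
  have "h j (col_len n lam j - i) j = i" "0 < i" "j \<in> {j..lam 1}"
    using assms heights_first by (auto simp: boxes_def)
  then show ?thesis
    using scanning_is_max[OF assms] by metis
qed

text \<open>Let column \<open>k\<close> supply the maximum for row \<open>i\<close>. If it was
  marked in the preceding round, its entry there was one row lower and strictly larger; if not, an
  earlier column strictly beat it in that round.\<close>

lemma scanning_less_Suc:
  assumes "(j, i) \<in> boxes n lam" "(j, Suc i) \<in> boxes n lam"
  shows "scanning n lam T j i < scanning n lam T j (Suc i)"
proof -
  \<comment> \<open>Rows are filled from the bottom up: row \<open>Suc i\<close> is filled after
    \<open>t\<close> rounds, row \<open>i\<close> after one more.\<close>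
  define t where "t = col_len n lam j - Suc i"
  have t: "col_len n lam j - i = Suc t" and j: "1 \<le> j"
    using assms by (auto simp: t_def boxes_def)
  obtain k where k: "k \<in> {j..lam 1}" "0 < h j (Suc t) k"
    "scanning n lam T j i = T k (h j (Suc t) k)"
    using scanning_is_max[OF assms(1)] t by metis
  have max: "T l (h j t l) \<le> scanning n lam T j (Suc i)"
    if "l \<in> {j..lam 1}" "0 < h j t l" for l
    using scanning_is_max[OF assms(2)] that unfolding t_def by metis
  show ?thesis
  proof (cases "left_max T j (h j t) k")
    case True
    then have "T k (h j (Suc t) k) < T k (h j t k)"
      using k j heights_le by (intro column_less) auto
    also have "\<dots> \<le> scanning n lam T j (Suc i)"
      using k True by (intro max) auto
    finally show ?thesis
      using k by simp
  next
    case False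
    then obtain l where l: "l \<in> {j..k}" "T k (h j t k) < T l (h j t l)"
      by (auto simp: left_max_def not_le)
    have "0 < h j t k"
      using k(2) False by simp
    then have "0 < h j t l"
      using monotone_onD[OF antimono_heights[OF j], of l k t] k l by auto
    then have "T l (h j t l) \<le> scanning n lam T j (Suc i)"
      using k l by (intro max) auto
    then show ?thesis
      using k(3) l(2) False by simp
  qed
qed

end

section \<open>Entries of a column given by a set\<close>

text \<open>Turns bounds on the \<open>i\<close>-th smallest element into counts, which can be
  compared between two key columns.\<close>

lemma col_of_set_le_iff:
  assumes "finite Q" "i \<in> {1..card Q}"
  shows "col_of_set Q i \<le> v \<longleftrightarrow> i \<le> card {x \<in> Q. x \<le> v}"
proof -
  define xs where "xs = sorted_list_of_set Q"
  have xs: "sorted xs" "distinct xs" "set xs = Q" "length xs = card Q"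
    using assms by (auto simp: xs_def)
  show ?thesis
  proof
    assume "col_of_set Q i \<le> v"
    then have le: "xs ! (i - 1) \<le> v"
      by (simp add: col_of_set_def xs_def)
    have "xs ! m \<le> v" if "m < i" for m
      using sorted_nth_mono[OF xs(1), of m "i - 1"] that le assms xs(4) by force
    then have "set (take i xs) \<subseteq> {x \<in> Q. x \<le> v}"
      using xs(3) set_take_subset[of i xs] by (force simp: in_set_conv_nth)
    then have "card (set (take i xs)) \<le> card {x \<in> Q. x \<le> v}"
      using assms by (intro card_mono) auto
    then show "i \<le> card {x \<in> Q. x \<le> v}"
      using assms xs by (simp add: distinct_card)
  next
    assume i: "i \<le> card {x \<in> Q. x \<le> v}"
    show "col_of_set Q i \<le> v"
    proof (rule ccontr)
      assume "\<not> col_of_set Q i \<le> v"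
      then have gt: "v < xs ! (i - 1)"
        by (simp add: col_of_set_def xs_def)
      have "{x \<in> Q. x \<le> v} \<subseteq> set (take (i - 1) xs)"
      proof
        fix x
        assume x: "x \<in> {x \<in> Q. x \<le> v}"
        then obtain m where m: "m < length xs" "x = xs ! m"
          using xs(3) by (auto simp: in_set_conv_nth)
        have "m < i - 1"
          using sorted_nth_mono[OF xs(1), of "i - 1" m] m gt x by force
        then show "x \<in> set (take (i - 1) xs)"
          using m by (auto simp: in_set_conv_nth)
      qed
      then have "card {x \<in> Q. x \<le> v} \<le> card (set (take (i - 1) xs))"
        by (intro card_mono) auto
      also have "\<dots> \<le> i - 1"
        using card_length[of "take (i - 1) xs"] by simp
      finally show False
        using i assms(2) by auto
    qed
  qed
qed

section \<open>Carrels and the columns of the key\<close>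

locale partition =
  fixes n :: nat and lam :: "nat \<Rightarrow> nat"
  assumes n_pos: "1 \<le> n" and partition: "is_partition n lam"
begin

abbreviation "q \<equiv> qseq n lam"
abbreviation "r \<equiv> num_short n lam"

lemma col_len_pos: "j \<le> lam 1 \<Longrightarrow> 0 < col_len n lam j"
  using le_col_len_iff[OF partition, of 1 j] n_pos by auto

lemma finite_short_lens: "finite (short_lens n lam)"
  by (simp add: short_lens_def)

lemma qseq_0: "q 0 = 0" and qseq_last: "q (Suc r) = n"
  by (simp_all add: qseq_def num_short_def nth_append)

text \<open>Columns up to \<open>lam 1\<close> are nonempty and short lengths are below
  \<open>n\<close>, so the end values 0 and \<open>n\<close> keep the sorted list strictly
  increasing.\<close>

lemma qseq_less:
  assumes "g < h" "h \<le> Suc r"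
  shows "q g < q h"
proof -
  let ?L = "0 # sorted_list_of_set (short_lens n lam) @ [n]"
  have "q' \<in> short_lens n lam \<Longrightarrow> 0 < q' \<and> q' < n" for q'
    using col_len_pos by (auto simp: short_lens_def)
  then have "sorted_wrt (<) ?L"
    using n_pos finite_short_lens by (auto simp: sorted_wrt_append)
  then show ?thesis
    using assms unfolding qseq_def num_short_def
    by (intro sorted_wrt_nth_less[of "(<)" ?L]) auto
qed

lemma qseq_le: "g \<le> h \<Longrightarrow> h \<le> Suc r \<Longrightarrow> q g \<le> q h"
  using qseq_less[of g h] by (cases "g = h") auto

lemma col_len_qseq:
  assumes "j \<in> {1..lam 1}"
  obtains h where "h \<in> {1..Suc r}" "col_len n lam j = q h"
proof (cases "col_len n lam j = n")
  case True
  then show ?thesis using that[of "Suc r"] qseq_last by simp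
next
  case False
  then have "col_len n lam j \<in> set (sorted_list_of_set (short_lens n lam))"
    using assms col_len_le[of n lam j] finite_short_lens by (auto simp: short_lens_def)
  then obtain m where "m < r" "sorted_list_of_set (short_lens n lam) ! m = col_len n lam j"
    by (auto simp: in_set_conv_nth num_short_def)
  then show ?thesis
    \<comment> \<open>The leading 0 shifts all indices by one.\<close>
    using that[of "Suc m"] by (simp add: qseq_def nth_append num_short_def)
qed

lemma qseq_bounds: "h \<in> {1..Suc r} \<Longrightarrow> q h \<in> {1..n}"
  using qseq_less[of 0 h] qseq_le[of h "Suc r"] qseq_0 qseq_last by auto

text \<open>By conjugation the length lies in the half-open interval from \<open>q h\<close> to
  \<open>q (Suc h)\<close>; being a value of \<open>q\<close>, it is \<open>q h\<close>.\<close>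

lemma col_len_eq_qseq:
  assumes "h \<in> {1..r}" "lam (q (Suc h)) < j" "j \<le> lam (q h)"
  shows "col_len n lam j = q h"
proof -
  have bounds: "q h \<in> {1..n}" "q (Suc h) \<in> {1..n}"
    using assms qseq_bounds by auto
  have "lam (q h) \<le> lam 1"
    using partition bounds by (auto simp: is_partition_def)
  then have "j \<in> {1..lam 1}"
    using assms by auto
  then obtain g where g: "g \<in> {1..Suc r}" "col_len n lam j = q g"
    by (rule col_len_qseq)
  have "q h \<le> q g" "q g < q (Suc h)"
    using le_col_len_iff[OF partition bounds(1), of j]
      le_col_len_iff[OF partition bounds(2), of j] assms g by auto
  then have "g = h"
    using qseq_less[of g h] qseq_le[of "Suc h" g] g assms(1) by force
  then show ?thesis
    using g by simp
qed

text \<open>The block sizes telescope: once block \<open>s\<close> has been appended there are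
  \<open>lam (q s)\<close> columns, and those of block \<open>s\<close> are the columns of length
  \<open>q s\<close>.\<close>

lemma key_columns_nth:
  assumes "\<pi> permutes {1..n}" "j \<in> {1..lam 1}"
  shows "key_columns n lam \<pi> ! (j - 1) = \<pi> ` {1..col_len n lam j}"
proof -
  \<comment> \<open>The initial part of the list, with blocks \<open>r\<close> down to
    \<open>s\<close>; the induction starts at \<open>s = Suc r\<close>, where no block has been
    appended.\<close>
  define P where "P s = replicate (lam n) {1..n} @
     concat (map (\<lambda>h. replicate (lam (q h) - lam (q (h + 1))) (\<pi> ` {1..q h}))
                 (rev [s..<r + 1]))" for s
  have P_last: "P (Suc r) = replicate (lam n) {1..n}"
    by (simp add: P_def)
  have P_step: "P s = P (Suc s) @ replicate (lam (q s) - lam (q (Suc s))) (\<pi> ` {1..q s})"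
    if "s \<le> r" for s
    using that by (simp add: P_def upt_conv_Cons del: upt_Suc)
  have "length (P s) = lam (q s) \<and>
    (\<forall>j \<in> {1..lam (q s)}. P s ! (j - 1) = \<pi> ` {1..col_len n lam j})"
    if "s \<le> Suc r" "1 \<le> s" for s
    using that
  proof (induction s rule: inc_induct)
    case base
    have "col_len n lam j = n" if "j \<le> lam n" for j
      using le_col_len_iff[OF partition, of n j] n_pos that col_len_le[of n lam j] by auto
    then show ?case
      using permutes_image[OF assms(1)] by (auto simp: P_last qseq_last)
  next
    case (step s)
    then have IH: "length (P (Suc s)) = lam (q (Suc s))"
      "\<And>j. j \<in> {1..lam (q (Suc s))} \<Longrightarrow> P (Suc s) ! (j - 1) = \<pi> ` {1..col_len n lam j}"
      by auto
    have "q s \<in> {1..n}" "q (Suc s) \<in> {1..n}" "q s \<le> q (Suc s)"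
      using step qseq_bounds[of s] qseq_bounds[of "Suc s"] qseq_le[of s "Suc s"] by auto
    then have le: "lam (q (Suc s)) \<le> lam (q s)"
      using partition by (auto simp: is_partition_def)
    have P: "P s = P (Suc s) @ replicate (lam (q s) - lam (q (Suc s))) (\<pi> ` {1..q s})"
      using step P_step by simp
    have "P s ! (j - 1) = \<pi> ` {1..col_len n lam j}" if j: "j \<in> {1..lam (q s)}" for j
    proof (cases "j \<le> lam (q (Suc s))")
      case True
      then have "j - 1 < length (P (Suc s))"
        using j IH(1) by auto
      then show ?thesis
        using True j IH(2) by (simp add: P nth_append)
    next
      case False
      then have "col_len n lam j = q s"
        using col_len_eq_qseq[of s j] step j by auto
      moreover have "P s ! (j - 1) = \<pi> ` {1..q s}"
        using False j IH(1) by (auto simp: P nth_append)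
      ultimately show ?thesis by simp
    qed
    then show ?case
      using IH(1) le by (simp add: P)
  qed
  from this[of 1] have key: "j \<in> {1..lam (q 1)} \<Longrightarrow> P 1 ! (j - 1) = \<pi> ` {1..col_len n lam j}"
    by simp
  obtain h where h: "h \<in> {1..Suc r}" "col_len n lam j = q h"
    using assms(2) by (rule col_len_qseq)
  \<comment> \<open>No column is shorter than \<open>q 1\<close>, so the case \<open>s = 1\<close>
    covers all of them.\<close>
  then have "q 1 \<le> col_len n lam j"
    using qseq_le[of 1 h] by simp
  then have "j \<le> lam (q 1)"
    using le_col_len_iff[OF partition, of "q 1" j] qseq_bounds[of 1] by simp
  moreover have "key_columns n lam \<pi> = P 1"
    by (simp add: key_columns_def P_def)
  ultimately show ?thesis
    using key assms(2) by simp
qed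

lemma lam_key_eq:
  assumes "\<pi> permutes {1..n}" "(j, i) \<in> boxes n lam"
  shows "lam_key n lam \<pi> j i = col_of_set (\<pi> ` {1..col_len n lam j}) i"
  using assms key_columns_nth[OF assms(1), of j] by (auto simp: lam_key_def boxes_def)

section \<open>Keys of 312-avoiding permutations\<close>

text \<open>If \<open>w\<close> were missing from column \<open>j\<close>, then \<open>x\<close>,
  \<open>u\<close>, \<open>w\<close> would form a forbidden pattern: \<open>x\<close> sits within
  the first \<open>col_len n lam k\<close> positions, \<open>u\<close> after them but within the
  first \<open>col_len n lam j\<close>, and \<open>w\<close> beyond those.\<close>

lemma lam_key_gapless:
  assumes perm: "\<pi> permutes {1..n}" and avoid: "lam_312_avoiding n lam \<pi>"
    and j: "j \<in> {1..lam 1}" and k: "k \<in> {j..lam 1}"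
    and u: "u \<in> \<pi> ` {1..col_len n lam j} - \<pi> ` {1..col_len n lam k}"
    and x: "x \<in> \<pi> ` {1..col_len n lam k}" and w: "u < w" "w \<le> x"
  shows "w \<in> \<pi> ` {1..col_len n lam j}"
proof (rule ccontr)
  assume notin: "w \<notin> \<pi> ` {1..col_len n lam j}"
  have le: "col_len n lam k \<le> col_len n lam j" "col_len n lam j \<le> n"
    using k antimono_col_len col_len_le by auto
  obtain a where a: "a \<in> {1..col_len n lam k}" "x = \<pi> a"
    using x by auto
  obtain b where b: "b \<in> {1..col_len n lam j}" "b \<notin> {1..col_len n lam k}" "u = \<pi> b"
    using u by blast
  have "x \<in> \<pi> ` {1..n}"
    using a le by auto
  then have "w \<in> {1..n}"
    using w permutes_image[OF perm] by auto
  then obtain c where c: "c \<in> {1..n}" "w = \<pi> c"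
    using permutes_image[OF perm] by (metis imageE)
  have c': "col_len n lam j < c"
    using notin c by auto
  have wx: "w < x"
    using w notin a le by (cases "w = x") auto
  obtain g where g: "g \<in> {1..Suc r}" "col_len n lam k = q g"
    using col_len_qseq[of k] j k by auto
  obtain g' where g': "g' \<in> {1..Suc r}" "col_len n lam j = q g'"
    using col_len_qseq[OF j] by auto
  \<comment> \<open>The lengths of columns \<open>k\<close> and \<open>j\<close> may be several
    carrels apart, whereas the pattern asks for the carrel right after \<open>q h\<close>; so
    \<open>h\<close> is chosen by the carrel containing \<open>b\<close>.\<close>
  define h where "h = (LEAST h. b \<le> q (Suc h))"
  have "b \<le> q (Suc (g' - 1))"
    using g' b by simp
  then have h: "b \<le> q (Suc h)" "h \<le> g' - 1"
    unfolding h_def by (auto intro: LeastI Least_le)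
  have gh: "g \<le> h"
  proof (rule ccontr)
    assume "\<not> g \<le> h"
    then have "q (Suc h) \<le> q g"
      using g by (intro qseq_le) auto
    then show False using h b g by auto
  qed
  have "q h < b"
  proof (rule ccontr)
    assume "\<not> q h < b"
    then have "b \<le> q (Suc (h - 1))"
      using gh g by auto
    then have "h \<le> h - 1"
      unfolding h_def by (rule Least_le)
    then show False
      using gh g by auto
  qed
  \<comment> \<open>The position \<open>c\<close> lies beyond column \<open>j\<close>, which is
    therefore shorter than \<open>n\<close>.\<close>
  moreover have hr: "h < r"
  proof (rule ccontr)
    assume "\<not> h < r"
    then have "g' = Suc r"
      using h g' by auto
    then show False
      using g' c c' qseq_last by simp
  qed
  moreover have "q (Suc h) < c"
    using qseq_le[of "Suc h" g'] h g' c' by (cases g') auto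
  moreover have "a \<le> q h"
    using a g qseq_le[of g h] gh hr by auto
  ultimately have "lam_312_containing n lam \<pi>"
    unfolding lam_312_containing_def using a b c h gh g w wx
    by (intro bexI[of _ h] exI[of _ a] exI[of _ b] exI[of _ c]) auto
  then show False
    using avoid by (simp add: lam_312_avoiding_def)
qed

lemma scanning_le_lam_key:
  assumes perm: "\<pi> permutes {1..n}" and avoid: "lam_312_avoiding n lam \<pi>"
    and T: "T \<in> tableaux n lam" and le: "tab_le n lam T (lam_key n lam \<pi>)"
    and box: "(j, i) \<in> boxes n lam"
  shows "scanning n lam T j i \<le> lam_key n lam \<pi> j i"
proof -
  interpret tableau n lam T by unfold_locales (rule T)
  define A where "A k = \<pi> ` {1..col_len n lam k}" for k
  have card: "finite (A k)" "card (A k) = col_len n lam k" for k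
    using card_image[OF inj_on_subset[OF permutes_inj[OF perm]]] by (auto simp: A_def)
  note key = lam_key_eq[OF perm, folded A_def]
  from box have j: "j \<in> {1..lam 1}" "0 < i" and "i \<le> col_len n lam j"
    by (auto simp: boxes_def)
  then show ?thesis
  \<comment> \<open>The measure makes the induction run from the bottom row upward.\<close>
  proof (induction i rule: measure_induct_rule[of "\<lambda>i. col_len n lam j - i"])
    case (less i)
    then have box: "(j, i) \<in> boxes n lam"
      by (auto simp: boxes_def)
    define v where "v = lam_key n lam \<pi> j i"
    obtain k m where k: "k \<in> {j..lam 1}" "0 < m" "m \<le> i" "m \<le> col_len n lam k"
      "scanning n lam T j i = T k m"
      using scanning_is_max[OF box] heights_le by metis
    have box': "(k, m) \<in> boxes n lam"
      using k j by (auto simp: boxes_def)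
    have Tkm: "T k m \<le> lam_key n lam \<pi> k m"
      using le box' by (auto simp: tab_le_def)
    show ?case
    proof (cases "lam_key n lam \<pi> k m \<le> v")
      case True
      then show ?thesis using Tkm k(5) by (simp add: v_def)
    next
      case False
      \<comment> \<open>In terms of counts: \<open>A k\<close> has fewer than \<open>m\<close>
        elements up to \<open>v\<close>, while \<open>A j\<close> has at least \<open>i\<close>,
        hence at least \<open>m\<close>.\<close>
      then have "\<not> m \<le> card {x \<in> A k. x \<le> v}"
        using col_of_set_le_iff[OF card(1), of m k v] k key[OF box'] card by auto
      moreover have Aj: "i \<le> card {x \<in> A j. x \<le> v}"
        using col_of_set_le_iff[OF card(1), of i j v] less.prems key[OF box] card
        by (auto simp: v_def)
      ultimately have few: "card {x \<in> A k. x \<le> v} < m" "m \<le> card {x \<in> A j. x \<le> v}"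
        using k by auto
      have "\<not> {x \<in> A j. x \<le> v} \<subseteq> {x \<in> A k. x \<le> v}"
        using few card_mono[of "{x \<in> A k. x \<le> v}" "{x \<in> A j. x \<le> v}"] card(1) by auto
      then obtain u where u: "u \<in> A j - A k" "u \<le> v"
        by auto
      \<comment> \<open>Column \<open>k\<close> has at least \<open>m\<close> entries, so one of
        them exceeds \<open>v\<close>.\<close>
      have "{x \<in> A k. x \<le> v} \<noteq> A k"
        using few k card(2)[of k] by auto
      then obtain x where x: "x \<in> A k" "v < x"
        using not_le by blast
      have Suc_v: "Suc v \<in> A j"
        using lam_key_gapless[OF perm avoid j(1) k(1), of u x "Suc v"] u x by (auto simp: A_def)
      have "insert (Suc v) {x \<in> A j. x \<le> v} \<subseteq> {x \<in> A j. x \<le> Suc v}"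
        using Suc_v by auto
      then have "card (insert (Suc v) {x \<in> A j. x \<le> v}) \<le> card {x \<in> A j. x \<le> Suc v}"
        using card(1) by (intro card_mono) auto
      \<comment> \<open>This count serves twice: row \<open>Suc i\<close> exists in column
        \<open>j\<close>, and its key entry is at most \<open>Suc v\<close>.\<close>
      then have Suc_i: "Suc i \<le> card {x \<in> A j. x \<le> Suc v}"
        using Aj card(1)[of j] by simp
      also have "\<dots> \<le> card (A j)"
        using card(1) by (intro card_mono) auto
      finally have len: "Suc i \<le> col_len n lam j"
        by (simp add: card)
      then have box_Suc: "(j, Suc i) \<in> boxes n lam"
        using j by (auto simp: boxes_def)
      have "scanning n lam T j i < scanning n lam T j (Suc i)"
        using box box_Suc by (rule scanning_less_Suc)
      also have "\<dots> \<le> lam_key n lam \<pi> j (Suc i)"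
        using less.IH[of "Suc i"] len j by auto
      also have "\<dots> \<le> Suc v"
        using col_of_set_le_iff[OF card(1), of "Suc i" j "Suc v"] Suc_i len card key[OF box_Suc]
        by auto
      finally show ?thesis
        by (simp add: v_def)
    qed
  qed
qed

end

section \<open>The Demazure set as a principal ideal\<close>

theorem theorem10p3:
  fixes n :: nat and lam \<pi> :: "nat \<Rightarrow> nat"
  assumes "1 \<le> n"
    and "is_partition n lam"
    and "is_lam_perm n lam \<pi>"
    and "lam_312_avoiding n lam \<pi>"
  shows "demazure n lam \<pi> = principal_ideal n lam (lam_key n lam \<pi>)"
proof -
  interpret partition n lam
    using assms by unfold_locales
  have perm: "\<pi> permutes {1..n}"
    using assms by (simp add: is_lam_perm_def)
  have "tab_le n lam (scanning n lam T) (lam_key n lam \<pi>) \<longleftrightarrow>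
    tab_le n lam T (lam_key n lam \<pi>)" if T: "T \<in> tableaux n lam" for T
  proof
    interpret tableau n lam T by unfold_locales (rule T)
    assume "tab_le n lam (scanning n lam T) (lam_key n lam \<pi>)"
    then show "tab_le n lam T (lam_key n lam \<pi>)"
      using le_scanning unfolding tab_le_def by (blast intro: le_trans)
  next
    assume "tab_le n lam T (lam_key n lam \<pi>)"
    then have "scanning n lam T j i \<le> lam_key n lam \<pi> j i" if "(j, i) \<in> boxes n lam" for j i
      using scanning_le_lam_key[OF perm assms(4) T _ that] by blast
    then show "tab_le n lam (scanning n lam T) (lam_key n lam \<pi>)"
      by (auto simp: tab_le_def)
  qed
  then show ?thesis
    by (auto simp: demazure_def principal_ideal_def)
qed

end
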